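(* For every positive integer $d$, the cover pebbling number of the $d$-dimensional hypercube $Q^d$ satisfies $\gamma(Q^d)=3^d$.
   Context: The $d$-dimensional hypercube $Q^d$ has vertex set $\{0,1\}^d$, two vertices being adjacent iff they differ in exactly one coordinate. A configuration of pebbles on a graph $G$ is a function $C:V(G)\to\{0,1,2,\ldots\}$; its size is $|C|=\sum_{x}C(x)$. A pebbling step removes two pebbles from one vertex and places one pebble on an adjacent vertex. The cover pebbling number $\gamma(G)$ is the minimum number $m$ such that every configuration of size $m$ has the property that, after some sequence of pebbling steps, every vertex has at least one pebble on it. *)

theory Defs
  imports "Graph_Theory.Pair_Digraph"
begin

text \<open>
  An undirected simple graph is a \<^locale>\<open>pair_graph\<close>: each edge \<open>{u, v}\<close> is the pair of
  arcs \<open>(u, v)\<close> and \<open>(v, u)\<close>.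
\<close>

definition hypercube :: "nat \<Rightarrow> bool list pair_pre_digraph" where
  "hypercube d =
    \<lparr>pverts = {x. length x = d},
     parcs = {(x, y). length x = d \<and> length y = d \<and> card {i. i < d \<and> x ! i \<noteq> y ! i} = 1}\<rparr>"

text \<open>
  Configurations are total functions, but the notions below depend only on their
  values on the vertices of the graph.
\<close>

type_synonym 'a pebble_config = "'a \<Rightarrow> nat"

definition config_size :: "'a pair_pre_digraph \<Rightarrow> 'a pebble_config \<Rightarrow> nat" where
  "config_size G C = (\<Sum>x\<in>pverts G. C x)"

definition pebbling_step ::
    "'a pair_pre_digraph \<Rightarrow> 'a pebble_config \<Rightarrow> 'a pebble_config \<Rightarrow> bool" where
  "pebbling_step G C C' \<longleftrightarrow>
    (\<exists>u v. u \<rightarrow>\<^bsub>G\<^esub> v \<and> C u \<ge> 2 \<and> C' = C(u := C u - 2, v := C v + 1))"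

definition cover_solvable :: "'a pair_pre_digraph \<Rightarrow> 'a pebble_config \<Rightarrow> bool" where
  "cover_solvable G C \<longleftrightarrow>
    (\<exists>C'. (pebbling_step G)\<^sup>*\<^sup>* C C' \<and> (\<forall>x\<in>pverts G. C' x \<ge> 1))"

definition cover_pebbling_number :: "'a pair_pre_digraph \<Rightarrow> nat" where
  "cover_pebbling_number G =
    (LEAST m. \<forall>C. config_size G C = m \<longrightarrow> cover_solvable G C)"

lemma adj_hypercube_iff:
  "x \<rightarrow>\<^bsub>hypercube d\<^esub> y \<longleftrightarrow>
    length x = d \<and> length y = d \<and> card {i. i < d \<and> x ! i \<noteq> y ! i} = 1"
  by (simp add: hypercube_def arcs_ends_def arc_to_ends_def)

lemma pair_graph_hypercube: "pair_graph (hypercube d)"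
proof
  show "finite (pverts (hypercube d))"
    using finite_lists_length_eq[of "UNIV :: bool set" d] by (simp add: hypercube_def)
  show "finite (parcs (hypercube d))"
  proof (rule finite_subset)
    show "parcs (hypercube d) \<subseteq> pverts (hypercube d) \<times> pverts (hypercube d)"
      by (auto simp: hypercube_def)
    show "finite (pverts (hypercube d) \<times> pverts (hypercube d))"
      using finite_lists_length_eq[of "UNIV :: bool set" d] by (simp add: hypercube_def)
  qed
  show "symmetric (with_proj (hypercube d))"
    unfolding symmetric_def
  proof (rule symI)
    fix x y
    assume "x \<rightarrow>\<^bsub>hypercube d\<^esub> y"
    moreover have "{i. i < d \<and> y ! i \<noteq> x ! i} = {i. i < d \<and> x ! i \<noteq> y ! i}"
      by auto
    ultimately show "y \<rightarrow>\<^bsub>hypercube d\<^esub> x"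
      by (simp only: adj_hypercube_iff)
  qed
  fix e
  assume "e \<in> parcs (hypercube d)"
  then show "fst e \<in> pverts (hypercube d)" "snd e \<in> pverts (hypercube d)" "fst e \<noteq> snd e"
    by (cases e; force simp: hypercube_def)+
qed

end

theory Submission
  imports Defs
begin

text \<open>
  Upper bound, by induction on the dimension: split a configuration of at least \<open>3 ^ (d + 1)\<close>
  pebbles on \<open>Q\<^sup>d\<^sup>+\<^sup>1\<close> along the first coordinate. If one half carries only \<open>a < 3 ^ d\<close> pebbles, send
  \<open>3 ^ d - a\<close> pebbles straight across. This leaves at least \<open>3 ^ d + a \<ge> 2 ^ d\<close> pebbles on the other
  half, so by the pigeonhole principle there was always a vertex with two pebbles to move from.
  Now both halves carry at least \<open>3 ^ d\<close> pebbles.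

  Lower bound: if a pebble on \<open>x\<close> has weight \<open>2\<close> to the number of ones in \<open>x\<close>, then no step
  increases the total weight. A cover weighs at least \<open>3 ^ d\<close>, while \<open>m\<close> pebbles at the origin
  weigh \<open>m\<close>.
\<close>

section \<open>Hypercubes\<close>

lemma pverts_hypercube [simp]: "pverts (hypercube d) = {x. length x = d}"
  by (simp add: hypercube_def)

lemma finite_bool_lists_length [simp]: "finite {x :: bool list. length x = d}"
  using finite_lists_length_eq[of "UNIV :: bool set" d] by simp

lemma card_bool_lists_length: "card {x :: bool list. length x = d} = 2 ^ d"
  using card_lists_length_eq[of "UNIV :: bool set" d] by simp

text \<open>The parameter \<open>b\<close> chooses which half comes first, so a half can be singled
  out without fixing the value of its first coordinate.\<close>

lemma sum_bool_lists_Suc: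
  fixes f :: "bool list \<Rightarrow> 'a::comm_monoid_add"
  shows "(\<Sum>x | length x = Suc d. f x) =
    (\<Sum>x | length x = d. f (b # x)) + (\<Sum>x | length x = d. f ((\<not> b) # x))"
proof -
  let ?L = "{x :: bool list. length x = d}"
  have "{x :: bool list. length x = Suc d} = (#) b ` ?L \<union> (#) (\<not> b) ` ?L"
    by (auto simp: length_Suc_conv image_iff)
  moreover have "(#) b ` ?L \<inter> (#) (\<not> b) ` ?L = {}"
    by auto
  ultimately show ?thesis
    by (simp add: sum.union_disjoint sum.reindex inj_on_def)
qed

text \<open>Differing positions of the tails are shifted by \<open>Suc\<close>, and position 0 adds
  one exactly when the heads differ. This gives the recursive picture of the cube: two copies joined
  by a perfect matching.\<close>

lemma adj_hypercube_Cons_iff: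
  "(b # x) \<rightarrow>\<^bsub>hypercube (Suc d)\<^esub> (c # y) \<longleftrightarrow>
    b = c \<and> x \<rightarrow>\<^bsub>hypercube d\<^esub> y \<or> b \<noteq> c \<and> x = y \<and> length x = d"
proof -
  let ?D = "{i. i < d \<and> x ! i \<noteq> y ! i}"
  have "{i. i < Suc d \<and> (b # x) ! i \<noteq> (c # y) ! i} = (if b = c then {} else {0}) \<union> Suc ` ?D"
    (is "?A = ?B")
  proof (rule set_eqI)
    fix i
    show "i \<in> ?A \<longleftrightarrow> i \<in> ?B"
      by (cases i) auto
  qed
  then have "card {i. i < Suc d \<and> (b # x) ! i \<noteq> (c # y) ! i} =
      (if b = c then 0 else 1) + card ?D"
    by (auto simp: card_image)
  moreover have "card ?D = 0 \<longleftrightarrow> x = y" if "length x = d" "length y = d"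
    using that by (auto simp: list_eq_iff_nth_eq)
  ultimately show ?thesis
    unfolding adj_hypercube_iff by auto
qed

section \<open>Upper bound\<close>

text \<open>Prefixing \<open>b\<close> turns each step on the smaller cube into a step inside one
  half. That the other half stays untouched lets the two halves be covered one after the
  other.\<close>

lemma pebbling_steps_lift_Cons:
  assumes "(pebbling_step (hypercube d))\<^sup>*\<^sup>* (\<lambda>x. C (b # x)) D"
  shows "\<exists>C'. (pebbling_step (hypercube (Suc d)))\<^sup>*\<^sup>* C C' \<and>
    (\<forall>x. C' (b # x) = D x) \<and> (\<forall>x. C' ((\<not> b) # x) = C ((\<not> b) # x))"
  using assms
proof (induction rule: rtranclp_induct)
  case base
  then show ?case
    by blast
next
  case (step D D')
  then obtain C' where C': "(pebbling_step (hypercube (Suc d)))\<^sup>*\<^sup>* C C'"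
      "\<forall>x. C' (b # x) = D x" "\<forall>x. C' ((\<not> b) # x) = C ((\<not> b) # x)"
    by blast
  from step.hyps(2) obtain u v where uv: "u \<rightarrow>\<^bsub>hypercube d\<^esub> v" "D u \<ge> 2"
      "D' = D(u := D u - 2, v := D v + 1)"
    unfolding pebbling_step_def by blast
  let ?C = "C'(b # u := C' (b # u) - 2, b # v := C' (b # v) + 1)"
  have "(b # u) \<rightarrow>\<^bsub>hypercube (Suc d)\<^esub> (b # v)"
    using uv(1) unfolding adj_hypercube_Cons_iff by blast
  then have "pebbling_step (hypercube (Suc d)) C' ?C"
    unfolding pebbling_step_def using uv(2) C'(2) by metis
  with C'(1) have "(pebbling_step (hypercube (Suc d)))\<^sup>*\<^sup>* C ?C"
    by (meson rtranclp.rtrancl_into_rtrancl)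
  moreover have "\<forall>x. ?C (b # x) = D' x" "\<forall>x. ?C ((\<not> b) # x) = C ((\<not> b) # x)"
    using C'(2,3) uv(3) by auto
  ultimately show ?case
    by blast
qed

text \<open>The summand \<open>2 ^ d\<close> is the number of vertices in the half: before each of
  the \<open>k\<close> moves at least \<open>2 ^ d + 2\<close> pebbles remain there, so some vertex
  holds two.\<close>

lemma pebbling_steps_across:
  assumes "2 * k + 2 ^ d \<le> (\<Sum>x | length x = d. C (b # x))"
  shows "\<exists>C'. (pebbling_step (hypercube (Suc d)))\<^sup>*\<^sup>* C C' \<and>
    (\<Sum>x | length x = d. C' (b # x)) + 2 * k = (\<Sum>x | length x = d. C (b # x)) \<and>
    (\<Sum>x | length x = d. C' ((\<not> b) # x)) = (\<Sum>x | length x = d. C ((\<not> b) # x)) + k"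
  using assms
proof (induction k)
  case 0
  then show ?case
    by auto
next
  case (Suc k)
  let ?L = "{x :: bool list. length x = d}"
  obtain C' where C': "(pebbling_step (hypercube (Suc d)))\<^sup>*\<^sup>* C C'"
      "(\<Sum>x\<in>?L. C' (b # x)) + 2 * k = (\<Sum>x\<in>?L. C (b # x))"
      "(\<Sum>x\<in>?L. C' ((\<not> b) # x)) = (\<Sum>x\<in>?L. C ((\<not> b) # x)) + k"
    using Suc by auto
  have "\<exists>x\<in>?L. C' (b # x) \<ge> 2"
  proof (rule ccontr)
    assume "\<not> ?thesis"
    then have "(\<Sum>x\<in>?L. C' (b # x)) \<le> (\<Sum>x\<in>?L. 1)"
      by (intro sum_mono) force
    then show False
      using Suc.prems C'(2) by (simp add: card_bool_lists_length)
  qed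
  then obtain x where x: "x \<in> ?L" "C' (b # x) \<ge> 2"
    by blast
  define E where "E = C'(b # x := C' (b # x) - 2, (\<not> b) # x := C' ((\<not> b) # x) + 1)"
  have "(b # x) \<rightarrow>\<^bsub>hypercube (Suc d)\<^esub> ((\<not> b) # x)"
    using x(1) unfolding adj_hypercube_Cons_iff by simp
  then have "pebbling_step (hypercube (Suc d)) C' E"
    unfolding pebbling_step_def E_def using x(2) by blast
  with C'(1) have "(pebbling_step (hypercube (Suc d)))\<^sup>*\<^sup>* C E"
    by (meson rtranclp.rtrancl_into_rtrancl)
  moreover have "(\<Sum>y\<in>?L. E (b # y)) + 2 = (\<Sum>y\<in>?L. C' (b # y))"
    using x by (simp add: E_def sum.remove[of ?L x])
  moreover have "(\<Sum>y\<in>?L. E ((\<not> b) # y)) = (\<Sum>y\<in>?L. C' ((\<not> b) # y)) + 1"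
    using x by (simp add: E_def sum.remove[of ?L x])
  ultimately show ?case
    using C'(2,3) by (intro exI[of _ E]) simp
qed

lemma cover_solvable_steps:
  assumes "(pebbling_step G)\<^sup>*\<^sup>* C C'" "cover_solvable G C'"
  shows "cover_solvable G C"
  using assms unfolding cover_solvable_def by (meson rtranclp_trans)

lemma cover_solvable_hypercube_Suc:
  assumes "\<And>b. cover_solvable (hypercube d) (\<lambda>x. C (b # x))"
  shows "cover_solvable (hypercube (Suc d)) C"
proof -
  let ?R = "(pebbling_step (hypercube (Suc d)))\<^sup>*\<^sup>*"
  obtain D where D: "(pebbling_step (hypercube d))\<^sup>*\<^sup>* (\<lambda>x. C (True # x)) D"
      "\<And>x. length x = d \<Longrightarrow> D x \<ge> 1"
    using assms[of True] unfolding cover_solvable_def by auto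
  obtain E where E: "(pebbling_step (hypercube d))\<^sup>*\<^sup>* (\<lambda>x. C (False # x)) E"
      "\<And>x. length x = d \<Longrightarrow> E x \<ge> 1"
    using assms[of False] unfolding cover_solvable_def by auto
  obtain C1 where C1: "?R C C1" "\<forall>x. C1 (True # x) = D x" "\<forall>x. C1 (False # x) = C (False # x)"
    using pebbling_steps_lift_Cons[OF D(1)] by auto
  \<comment> \<open>The first phase left this half as it was in \<open>C\<close>, so its solution
    still applies.\<close>
  have "(pebbling_step (hypercube d))\<^sup>*\<^sup>* (\<lambda>x. C1 (False # x)) E"
    using E(1) C1(3) by simp
  then obtain C2 where C2: "?R C1 C2" "\<forall>x. C2 (False # x) = E x" "\<forall>x. C2 (True # x) = C1 (True # x)"
    using pebbling_steps_lift_Cons[of d C1 False E] by auto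
  have "C2 x \<ge> 1" if x: "length x = Suc d" for x
  proof -
    obtain b y where "x = b # y" "length y = d"
      using x by (auto simp: length_Suc_conv)
    then show ?thesis
      using C1 C2 D(2) E(2) by (cases b) auto
  qed
  then show ?thesis
    unfolding cover_solvable_def using rtranclp_trans[OF C1(1) C2(1)] by auto
qed

text \<open>The bound is an inequality so that the induction hypothesis also applies to a half
  carrying more than \<open>3 ^ d\<close> pebbles.\<close>

lemma cover_solvable_hypercube:
  assumes "config_size (hypercube d) C \<ge> 3 ^ d"
  shows "cover_solvable (hypercube d) C"
  using assms
proof (induction d arbitrary: C)
  case 0
  then show ?case
    unfolding cover_solvable_def config_size_def by auto
next
  case (Suc d)
  let ?S = "\<lambda>C b. \<Sum>x | length x = d. C (b # x)"
  have halves: "cover_solvable (hypercube (Suc d)) C'"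
    if "?S C' b \<ge> 3 ^ d" "?S C' (\<not> b) \<ge> 3 ^ d" for C' b
  proof (rule cover_solvable_hypercube_Suc)
    fix c
    have "?S C' c \<ge> 3 ^ d"
      using that by (cases "c = b") auto
    then show "cover_solvable (hypercube d) (\<lambda>x. C' (c # x))"
      by (intro Suc.IH) (simp add: config_size_def)
  qed
  show ?case
  proof (cases "\<exists>b. ?S C (\<not> b) < 3 ^ d")
    case False
    then have "?S C (\<not> b) \<ge> 3 ^ d" for b
      by (simp add: not_less)
    from this[of False] this[of True] show ?thesis
      using halves[of C True] by simp
  next
    case True
    then obtain b where b: "?S C (\<not> b) < 3 ^ d"
      by blast
    define k where "k = 3 ^ d - ?S C (\<not> b)"
    have total: "3 * 3 ^ d \<le> ?S C b + ?S C (\<not> b)"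
      using Suc.prems sum_bool_lists_Suc[of C d b] by (simp add: config_size_def)
    \<comment> \<open>With \<open>a = ?S C (\<not> b)\<close>:
      \<open>2 * k + 2 ^ d \<le> 3 * 3 ^ d - 2 * a\<close>, and half \<open>b\<close> has at least
      \<open>3 * 3 ^ d - a\<close>.\<close>
    have "(2::nat) ^ d \<le> 3 ^ d"
      by (rule power_mono) auto
    then have "2 * k + 2 ^ d \<le> ?S C b"
      using total b unfolding k_def by linarith
    from pebbling_steps_across[OF this] obtain C' where C':
        "(pebbling_step (hypercube (Suc d)))\<^sup>*\<^sup>* C C'"
        "?S C' b + 2 * k = ?S C b" "?S C' (\<not> b) = ?S C (\<not> b) + k"
      by blast
    have "?S C' b \<ge> 3 ^ d" "?S C' (\<not> b) \<ge> 3 ^ d"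
      using C'(2,3) total b unfolding k_def by linarith+
    then show ?thesis
      using cover_solvable_steps[OF C'(1)] halves by blast
  qed
qed

section \<open>Lower bound\<close>

text \<open>The two pebbles leaving \<open>u\<close> weigh \<open>2 * w u\<close>, and the one
  arriving at \<open>v\<close> weighs \<open>w v\<close>, which is no more.\<close>

lemma pebbling_step_weight_mono:
  fixes w :: "'a \<Rightarrow> nat"
  assumes "pair_graph G" "\<And>u v. u \<rightarrow>\<^bsub>G\<^esub> v \<Longrightarrow> w v \<le> 2 * w u" "pebbling_step G C C'"
  shows "(\<Sum>x\<in>pverts G. w x * C' x) \<le> (\<Sum>x\<in>pverts G. w x * C x)"
proof -
  interpret pair_graph G by fact
  obtain u v where uv: "u \<rightarrow>\<^bsub>G\<^esub> v" "C u \<ge> 2" "C' = C(u := C u - 2, v := C v + 1)"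
    using assms(3) unfolding pebbling_step_def by blast
  have V: "u \<in> pverts G" "v \<in> pverts G" "u \<noteq> v"
    using uv(1) adj_not_same by (auto dest: adj_in_verts)
  \<comment> \<open>Writing the balance additively avoids truncated subtraction;
    \<open>C u \<ge> 2\<close> makes \<open>C u - 2\<close> exact.\<close>
  have "w x * C' x + (if x = u then 2 * w u else 0) = w x * C x + (if x = v then w v else 0)"
    for x
    using uv(2,3) V(3) by (auto simp: diff_mult_distrib2)
  then have "(\<Sum>x\<in>pverts G. w x * C' x + (if x = u then 2 * w u else 0)) =
      (\<Sum>x\<in>pverts G. w x * C x + (if x = v then w v else 0))"
    by simp
  then have "(\<Sum>x\<in>pverts G. w x * C' x) + 2 * w u = (\<Sum>x\<in>pverts G. w x * C x) + w v"
    using V by (simp add: sum.distrib)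
  then show ?thesis
    using assms(2)[OF uv(1)] by linarith
qed

text \<open>In a cover every vertex contributes its weight at least once, and steps never raise the
  total.\<close>

lemma cover_solvable_weight:
  fixes w :: "'a \<Rightarrow> nat"
  assumes "pair_graph G" "\<And>u v. u \<rightarrow>\<^bsub>G\<^esub> v \<Longrightarrow> w v \<le> 2 * w u" "cover_solvable G C"
  shows "(\<Sum>x\<in>pverts G. w x) \<le> (\<Sum>x\<in>pverts G. w x * C x)"
proof -
  obtain C' where C': "(pebbling_step G)\<^sup>*\<^sup>* C C'" "\<forall>x\<in>pverts G. C' x \<ge> 1"
    using assms(3) unfolding cover_solvable_def by blast
  have "(\<Sum>x\<in>pverts G. w x) \<le> (\<Sum>x\<in>pverts G. w x * C' x)"
    using C'(2) by (intro sum_mono) simp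
  also have "\<dots> \<le> (\<Sum>x\<in>pverts G. w x * C x)"
    using C'(1)
  proof (induction rule: rtranclp_induct)
    case (step D D')
    have "(\<Sum>x\<in>pverts G. w x * D' x) \<le> (\<Sum>x\<in>pverts G. w x * D x)"
      by (rule pebbling_step_weight_mono[OF assms(1,2) step.hyps(2)])
    with step.IH show ?case
      by linarith
  qed simp
  finally show ?thesis .
qed

text \<open>Read in exponents of 2, this is the condition \<open>w v \<le> 2 * w u\<close> for the
  weight used below.\<close>

lemma adj_hypercube_count_list_le:
  "x \<rightarrow>\<^bsub>hypercube d\<^esub> y \<Longrightarrow> count_list y True \<le> Suc (count_list x True)"
proof (induction d arbitrary: x y)
  case 0
  then show ?case
    unfolding adj_hypercube_iff by simp
next
  case (Suc d)
  obtain b x' c y' where xy: "x = b # x'" "y = c # y'"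
    using Suc.prems unfolding adj_hypercube_iff by (auto simp: length_Suc_conv)
  have "b = c \<and> x' \<rightarrow>\<^bsub>hypercube d\<^esub> y' \<or> b \<noteq> c \<and> x' = y'"
    using Suc.prems unfolding xy adj_hypercube_Cons_iff by blast
  then show ?case
    using Suc.IH[of x' y'] xy by auto
qed

text \<open>Prefixing \<open>False\<close> keeps a weight and prefixing \<open>True\<close> doubles
  it, so each dimension multiplies the total by 1 + 2.\<close>

lemma sum_power_count_list: "(\<Sum>x | length x = d. 2 ^ count_list x True) = (3 ^ d :: nat)"
proof (induction d)
  case (Suc d)
  then show ?case
    using sum_bool_lists_Suc[of "\<lambda>x. 2 ^ count_list x True :: nat" d True]
    by (simp flip: sum_distrib_left)
qed simp

lemma cover_solvable_origin_hypercube: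
  assumes "cover_solvable (hypercube d) (\<lambda>x. if x = replicate d False then m else 0)"
  shows "3 ^ d \<le> m"
proof -
  let ?C = "\<lambda>x. if x = replicate d False then m else 0"
  have "(2::nat) ^ count_list y True \<le> 2 * 2 ^ count_list x True"
    if "x \<rightarrow>\<^bsub>hypercube d\<^esub> y" for x y
    using power_increasing[OF adj_hypercube_count_list_le[OF that], of "2::nat"] by simp
  then have "(\<Sum>x | length x = d. 2 ^ count_list x True) \<le>
      (\<Sum>x | length x = d. 2 ^ count_list x True * ?C x)"
    using cover_solvable_weight[OF pair_graph_hypercube _ assms, of "\<lambda>x. 2 ^ count_list x True"]
    by simp
  \<comment> \<open>Only the origin carries pebbles, and its weight is
    \<open>2 ^ 0 = 1\<close>.\<close>
  also have "\<dots> = (\<Sum>x | length x = d. if x = replicate d False then m else 0)"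
    by (intro sum.cong) (auto simp: count_list_0_iff)
  finally show ?thesis
    by (simp add: sum_power_count_list)
qed

theorem theorem1:
  fixes d :: nat
  assumes "d \<ge> 1"
  shows "cover_pebbling_number (hypercube d) = 3 ^ d"
  unfolding cover_pebbling_number_def
proof (rule Least_equality)
  show "\<forall>C. config_size (hypercube d) C = 3 ^ d \<longrightarrow> cover_solvable (hypercube d) C"
    by (simp add: cover_solvable_hypercube)
next
  fix m
  assume m: "\<forall>C. config_size (hypercube d) C = m \<longrightarrow> cover_solvable (hypercube d) C"
  have "config_size (hypercube d) (\<lambda>x. if x = replicate d False then m else 0) = m"
    by (simp add: config_size_def)
  with m show "3 ^ d \<le> m"
    using cover_solvable_origin_hypercube by blast
qed

end
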